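(* Let $A\in\mathbb{R}^{n\times n}$ be symmetric positive definite with spectral decomposition $A=V\Lambda V^T+V_\perp\Lambda_\perp V_\perp^T$, where $(V,V_\perp)$ is an orthogonal matrix, $V\in\mathbb{R}^{n\times r}$, $\Lambda=\mathrm{diag}(\lambda_1,\dots,\lambda_r)$, $\Lambda_\perp=\mathrm{diag}(\lambda_{r+1},\dots,\lambda_n)$, $1\le r<n$, and every diagonal entry of $\Lambda$ is at most every diagonal entry of $\Lambda_\perp$. Let $Z\in\mathbb{R}^{n\times r}$ have orthonormal columns, let $E=Z^TAZ$, and let $P_C=I+ZE^{-1}Z^T$. Let $\theta$ be the acute angle between $\mathcal{V}=\mathrm{span}(V)$ and $\mathcal{Z}=\mathrm{span}(Z)$. If $\cos\theta\neq0$, then $$\lambda_{\max}(P_CA)\le\max\{1+\lambda_{\max}(\Lambda),\lambda_{\max}(\Lambda_\perp)\}+\epsilon_C,$$ $$\lambda_{\min}(P_CA)\ge\min\{1+\lambda_{\min}(\Lambda),\lambda_{\min}(\Lambda_\perp)\}-\epsilon_C,$$ where $\epsilon_C=\frac12\left(\lambda_{\max}(\Lambda_\perp)\|E^{-1}\|_2+1\right)\tan\theta+\sin\theta+\sin^2\theta$.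
   Context: For two subspaces $\mathcal{Z},\mathcal{V}\subset\mathbb{R}^n$ of the same dimension $r$ with orthonormal bases given by the columns of $Z$ and $V$, $\mathrm{dist}(\mathcal{Z},\mathcal{V})=\|ZZ^T-VV^T\|_2=\sigma_{\max}(Z^TV_\perp)\in[0,1]$, where the columns of $V_\perp$ form an orthonormal basis of $\mathcal{V}^\perp$ and $\sigma_{\max}$ is the largest singular value. The acute angle between them is $\theta=\arcsin \mathrm{dist}(\mathcal{Z},\mathcal{V})\in[0,\pi/2]$. $\lambda_{\min},\lambda_{\max}$ denote smallest and largest eigenvalues (the matrix $P_CA$ is similar to a symmetric positive definite matrix, so its eigenvalues are real), and $\|\cdot\|_2$ is the spectral norm. *)

theory Defs
  imports "HOL-Analysis.Analysis"
begin

definition sym_posdef :: "real^'n^'n \<Rightarrow> bool" where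
  "sym_posdef A \<longleftrightarrow> transpose A = A \<and> (\<forall>x. x \<noteq> 0 \<longrightarrow> 0 < x \<bullet> (A *v x))"

definition orthonormal_columns :: "real^'r^'n \<Rightarrow> bool" where
  "orthonormal_columns Z \<longleftrightarrow> transpose Z ** Z = mat 1"

definition diag_matrix :: "real^'r \<Rightarrow> real^'r^'r" where
  "diag_matrix d = (\<chi> i j. if i = j then d $ i else 0)"

definition hblock :: "real^'r^'n \<Rightarrow> real^'s^'n \<Rightarrow> real^('r + 's)^'n" where
  "hblock V W = (\<chi> i j. case j of Inl k \<Rightarrow> V $ i $ k | Inr l \<Rightarrow> W $ i $ l)"

(* orthogonal_matrix requires literally the same row and column index type, which
   a block matrix (V, W) does not have. This is the same condition for two index types;
   the two equations together force the types to have the same number of elements. *)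
definition orthogonal_square :: "real^'m^'n \<Rightarrow> bool" where
  "orthogonal_square Q \<longleftrightarrow> transpose Q ** Q = mat 1 \<and> Q ** transpose Q = mat 1"

definition eigenvalue :: "real^'n^'n \<Rightarrow> real \<Rightarrow> bool" where
  "eigenvalue M c \<longleftrightarrow> (\<exists>x. x \<noteq> 0 \<and> M *v x = c *s x)"

(* For matrices with only real eigenvalues, such as symmetric matrices and matrices
   similar to them. *)
definition lambda_max :: "real^'n^'n \<Rightarrow> real" where
  "lambda_max M = Max {c. eigenvalue M c}"

definition lambda_min :: "real^'n^'n \<Rightarrow> real" where
  "lambda_min M = Min {c. eigenvalue M c}"

definition spectral_norm :: "real^'m^'n \<Rightarrow> real" where
  "spectral_norm M = onorm ((*v) M)"

(* Distance and acute angle between the column spans of Z and V, where both matrices have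
   orthonormal columns. By projector_eq_if_same_span below the values depend only on the two
   subspaces and not on the bases chosen. *)
definition subspace_dist :: "real^'r^'n \<Rightarrow> real^'r^'n \<Rightarrow> real" where
  "subspace_dist Z V = spectral_norm (Z ** transpose Z - V ** transpose V)"

definition acute_angle :: "real^'r^'n \<Rightarrow> real^'r^'n \<Rightarrow> real" where
  "acute_angle Z V = arcsin (subspace_dist Z V)"

lemma projector_fixes_span:
  fixes Y :: "real^'s^'n"
  assumes Y: "orthonormal_columns Y" and x: "x \<in> span (columns Y)"
  shows "(Y ** transpose Y) *v x = x"
  using x
proof (induction rule: span_induct)
  case base
  show ?case
    by (auto simp: subspace_def matrix_vector_right_distrib matrix_vector_mult_scaleR)
next
  case (step x)
  then obtain z where z: "x = Y *v z"
    unfolding columns_image_basis by auto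
  have "(Y ** transpose Y) *v x = (Y ** (transpose Y ** Y)) *v z"
    by (simp add: z matrix_vector_mul_assoc matrix_mul_assoc)
  also have "\<dots> = x"
    using Y by (simp add: orthonormal_columns_def z)
  finally show ?case .
qed

lemma projector_mult_projector:
  fixes Z :: "real^'r^'n" and Y :: "real^'s^'n"
  assumes "orthonormal_columns Y" and "span (columns Z) \<subseteq> span (columns Y)"
  shows "(Y ** transpose Y) ** (Z ** transpose Z) = Z ** transpose Z"
proof -
  have "((Y ** transpose Y) ** (Z ** transpose Z)) *v x = (Z ** transpose Z) *v x" for x
  proof -
    have "Z *v (transpose Z *v x) \<in> span (columns Y)"
      using assms(2) matrix_vector_mult_in_columnspace by blast
    then show ?thesis
      using projector_fixes_span[OF assms(1)] by (simp only: flip: matrix_vector_mul_assoc)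
  qed
  then show ?thesis by (simp add: matrix_eq)
qed

lemma projector_eq_if_same_span:
  fixes Z :: "real^'r^'n" and Y :: "real^'s^'n"
  assumes Z: "orthonormal_columns Z" and Y: "orthonormal_columns Y"
    and span: "span (columns Z) = span (columns Y)"
  shows "Z ** transpose Z = Y ** transpose Y"
proof -
  have "Z ** transpose Z = (Y ** transpose Y) ** (Z ** transpose Z)"
    using projector_mult_projector[of Y Z] Y span by simp
  also have "\<dots> = transpose ((Z ** transpose Z) ** (Y ** transpose Y))"
    by (simp add: matrix_transpose_mul)
  also have "\<dots> = transpose (Y ** transpose Y)"
    using projector_mult_projector[of Z Y] Z span by simp
  also have "\<dots> = Y ** transpose Y"
    by (simp add: matrix_transpose_mul)
  finally show ?thesis .
qed

end

theory Submission
  imports Defs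
begin

text \<open>With R the square root of A and U = R Z, the Gram matrix of U is E, so
  conjugation by R turns the preconditioned matrix into A + P, where P is the orthogonal projector
  onto the range of U. Let W be the orthogonal projector onto the span of V. Then A + W is diagonal
  in the eigenbasis of A, with eigenvalues 1 + \<open>\<lambda>\<^sub>i\<close> on the span of V and those of
  \<open>\<Lambda>\<^sub>p\<close> on its complement, so everything reduces to bounding the norm of P - W. Since R commutes
  with W and is bounded on the complement of V by the square root of
  \<open>b = lambda_max \<Lambda>\<^sub>p\<close>, that norm is at most \<open>sqrt (b \<parallel>E\<^sup>-\<^sup>1\<parallel>) sin \<theta>\<close>.
  The arithmetic-geometric mean inequality turns this into the first summand of \<open>\<epsilon>\<^sub>C\<close>.\<close>

section \<open>Eigenvalues of symmetric matrices\<close>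

lemma inner_matrix_transpose:
  fixes M :: "real^'m^'n"
  shows "x \<bullet> (M *v y) = (transpose M *v x) \<bullet> y"
  by (simp add: dot_lmul_matrix transpose_matrix_vector)

lemma matrix_mult_add_right_distrib:
  fixes M N :: "real^'m^'n"
  shows "(M + N) ** K = M ** K + N ** K"
  by (simp add: vec_eq_iff matrix_matrix_mult_def distrib_right sum.distrib)

text \<open>A maximizer x of the quadratic form on the compact unit sphere is an eigenvector: a
  nonzero residual \<open>g = S *v x - m *\<^sub>R x\<close> would be a direction in which the
  Rayleigh quotient still grows.\<close>

lemma symmetric_has_eigenvalue:
  fixes S :: "real^'n^'n"
  assumes S: "transpose S = S"
  shows "\<exists>c. eigenvalue S c"
proof -
  let ?f = "\<lambda>x. x \<bullet> (S *v x)"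
  have "continuous_on (sphere 0 1) ?f"
    by (intro continuous_intros linear_continuous_on matrix_vector_mul_bounded_linear)
  moreover have "sphere (0::real^'n) 1 \<noteq> {}" by simp
  ultimately obtain x where x: "norm x = 1" and max: "\<And>y. norm y = 1 \<Longrightarrow> ?f y \<le> ?f x"
    using continuous_attains_sup[of "sphere (0::real^'n) 1" ?f] by auto
  define m where "m = ?f x"
  define g where "g = S *v x - m *\<^sub>R x"
  have rayleigh: "?f y \<le> m * (y \<bullet> y)" for y
  proof (cases "y = 0")
    case False
    then have "?f (inverse (norm y) *\<^sub>R y) \<le> m"
      using max[of "inverse (norm y) *\<^sub>R y"] by (simp add: m_def)
    then have "inverse (norm y) * (inverse (norm y) * ?f y) \<le> m"
      by (simp add: matrix_vector_mult_scaleR)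
    then show ?thesis
      using False by (simp add: field_simps power2_eq_square flip: power2_norm_eq_inner)
  qed simp
  define K where "K = m * (g \<bullet> g) - ?f g"
  have K: "K \<ge> 0" using rayleigh[of g] by (simp add: K_def)
  have "x \<bullet> x = 1" using x by (simp flip: power2_norm_eq_inner)
  moreover have "x \<bullet> (S *v g) = g \<bullet> (S *v x)"
    by (metis S inner_matrix_transpose inner_commute)
  moreover have "g \<bullet> (S *v x) = g \<bullet> g + m * (g \<bullet> x)"
    by (simp add: g_def inner_diff_right)
  \<comment> \<open>The defect in \<open>rayleigh\<close> along the line x + t g is a quadratic in t
    that vanishes at t = 0, with linear coefficient -2 (g . g).\<close>
  ultimately have expand: "m * ((x + t *\<^sub>R g) \<bullet> (x + t *\<^sub>R g)) - ?f (x + t *\<^sub>R g)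
      = t * (t * K - 2 * (g \<bullet> g))" for t
    by (simp add: K_def m_def[symmetric] matrix_vector_right_distrib matrix_vector_mult_scaleR
        inner_add_left inner_add_right inner_commute algebra_simps)
  have "g = 0"
  proof (rule ccontr)
    assume "g \<noteq> 0"
    then have pos: "g \<bullet> g > 0" by simp
    \<comment> \<open>Any t > 0 with t K < 2 (g . g) makes the defect negative. Dividing by K + 1
      also covers K = 0.\<close>
    define t where "t = (g \<bullet> g) / (K + 1)"
    have t: "t > 0" using pos K by (simp add: t_def)
    have "t * K - 2 * (g \<bullet> g) < 0"
    proof -
      have "t * K \<le> t * (K + 1)" using t by simp
      also have "\<dots> = g \<bullet> g" using K by (simp add: t_def)
      finally show ?thesis using pos by linarith
    qed
    then have "t * (t * K - 2 * (g \<bullet> g)) < 0" using t by (simp add: mult_pos_neg)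
    then show False using expand[of t] rayleigh[of "x + t *\<^sub>R g"] by simp
  qed
  then have "S *v x = m *s x" by (simp add: g_def scalar_mult_eq_scaleR)
  moreover have "x \<noteq> 0" using x by auto
  ultimately show ?thesis unfolding eigenvalue_def by blast
qed

text \<open>Eigenvectors for distinct eigenvalues are orthogonal, hence independent, hence finitely
  many. Finiteness is what gives the \<open>Max\<close> and \<open>Min\<close> in
  \<open>lambda_max\<close> and \<open>lambda_min\<close> their meaning.\<close>

lemma symmetric_finite_eigenvalues:
  fixes S :: "real^'n^'n"
  assumes S: "transpose S = S"
  shows "finite {c. eigenvalue S c}"
proof -
  let ?C = "{c. eigenvalue S c}"
  have "\<forall>c\<in>?C. \<exists>x. x \<noteq> 0 \<and> S *v x = c *\<^sub>R x"
    by (simp add: eigenvalue_def scalar_mult_eq_scaleR)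
  then obtain v where v: "\<And>c. c \<in> ?C \<Longrightarrow> v c \<noteq> 0 \<and> S *v v c = c *\<^sub>R v c"
    by (metis (no_types, lifting) bchoice)
  have orth: "v c \<bullet> v d = 0" if "c \<in> ?C" "d \<in> ?C" "c \<noteq> d" for c d
  proof -
    have "d * (v c \<bullet> v d) = v c \<bullet> (S *v v d)" using v[OF that(2)] by simp
    also have "\<dots> = c * (v c \<bullet> v d)"
      using v[OF that(1)] by (simp add: inner_matrix_transpose S)
    finally show ?thesis using that(3) by simp
  qed
  then have inj: "inj_on v ?C"
    by (metis (no_types, lifting) inj_onI inner_eq_zero_iff v)
  have "pairwise orthogonal (v ` ?C)"
    using orth by (auto simp: pairwise_def orthogonal_def)
  then have "independent (v ` ?C)"
    using v by (intro pairwise_orthogonal_independent) auto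
  then have "finite (v ` ?C)" using independent_bound by blast
  then show ?thesis using inj finite_imageD by blast
qed

section \<open>Norm estimates for orthogonal projectors\<close>

lemma norm_projector_pythagoras:
  fixes P :: "real^'n^'n"
  assumes "transpose P = P" "P ** P = P"
  shows "(norm (P *v x))\<^sup>2 + (norm (x - P *v x))\<^sup>2 = (norm x)\<^sup>2"
proof -
  have "(P *v x) \<bullet> (P *v x) = x \<bullet> (P *v x)"
    by (metis assms inner_matrix_transpose matrix_vector_mul_assoc)
  then show ?thesis
    by (simp add: power2_norm_eq_inner inner_diff_left inner_diff_right inner_commute)
qed

lemma norm_projector_residual_le:
  fixes P :: "real^'n^'n"
  assumes "transpose P = P" "P ** P = P"
  shows "norm (x - P *v x) \<le> norm x"
  using norm_projector_pythagoras[OF assms, of x]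
  by (metis le_add_same_cancel2 norm_ge_zero power2_le_imp_le zero_le_power2)

text \<open>The difference P - W is the sum of (1 - W) P and - W (1 - P), which have orthogonal ranges;
  the second is the adjoint of - (1 - P) W.\<close>
lemma norm_projector_diff_le:
  fixes P W :: "real^'n^'n"
  assumes P: "transpose P = P" "P ** P = P" and W: "transpose W = W" "W ** W = W"
    and s: "0 \<le> s"
    and PW: "\<And>x. norm (P *v x - W *v (P *v x)) \<le> s * norm (P *v x)"
    and WP: "\<And>x. norm (W *v x - P *v (W *v x)) \<le> s * norm (W *v x)"
  shows "norm (P *v x - W *v x) \<le> s * norm x"
proof -
  define a where "a = P *v x - W *v (P *v x)"
  define y where "y = x - P *v x"
  define b where "b = W *v y"
  have WW: "W *v (W *v z) = W *v z" and PP: "P *v (P *v z) = P *v z" for z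
    using W P by (simp_all add: matrix_vector_mul_assoc)
  have "P *v x - W *v x = a - b"
    by (simp add: a_def b_def y_def matrix_vector_mult_diff_distrib)
  moreover have "a \<bullet> b = 0"
    using W by (simp add: a_def b_def inner_matrix_transpose matrix_vector_mult_diff_distrib WW)
  ultimately have eq: "(norm (P *v x - W *v x))\<^sup>2 = (norm a)\<^sup>2 + (norm b)\<^sup>2"
    by (simp add: power2_norm_eq_inner inner_diff_left inner_diff_right inner_commute)
  have "(norm b)\<^sup>2 = b \<bullet> y"
    using W by (simp add: power2_norm_eq_inner b_def inner_matrix_transpose WW)
  \<comment> \<open>Since y lies in the kernel of P, removing \<open>P *v b\<close> leaves the inner
    product unchanged and brings b into the form that \<open>WP\<close> bounds.\<close>
  also have "\<dots> = (b - P *v b) \<bullet> y"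
  proof -
    have "(P *v b) \<bullet> y = b \<bullet> (P *v y)" by (simp add: inner_matrix_transpose P)
    also have "P *v y = 0" by (simp add: y_def matrix_vector_mult_diff_distrib PP)
    finally show ?thesis by (simp add: inner_diff_left)
  qed
  also have "\<dots> \<le> norm (b - P *v b) * norm y" by (rule norm_cauchy_schwarz)
  also have "\<dots> \<le> (s * norm b) * norm y"
    unfolding b_def by (intro mult_right_mono WP norm_ge_zero)
  finally have "norm b \<le> s * norm y"
    using s by (cases "b = 0") (simp_all add: power2_eq_square)
  moreover have "norm a \<le> s * norm (P *v x)" unfolding a_def by (rule PW)
  ultimately have "(norm a)\<^sup>2 + (norm b)\<^sup>2 \<le> (s * norm (P *v x))\<^sup>2 + (s * norm y)\<^sup>2"
    by (intro add_mono power_mono) auto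
  also have "\<dots> = (s * norm x)\<^sup>2"
    using norm_projector_pythagoras[OF P, of x]
    by (simp add: y_def power_mult_distrib flip: distrib_left)
  finally show ?thesis
    using eq s by (metis mult_nonneg_nonneg norm_ge_zero power2_le_imp_le)
qed

text \<open>This is where equality of the dimensions enters: for s < 1 every w in the range of V is the
  projection of some u in the range of U, and the multiple of u nearest to w is within
  s times the norm of w.\<close>
lemma equal_dim_projector_bound:
  fixes U V :: "real^'r^'n" and P :: "real^'n^'n"
  assumes P: "transpose P = P" "P ** P = P" and V: "orthonormal_columns V"
    and PU: "\<And>g. P *v (U *v g) = U *v g"
    and inj: "\<And>g. U *v g = 0 \<Longrightarrow> g = 0"
    and s: "0 \<le> s"
    and UV: "\<And>g. norm (U *v g - V *v (transpose V *v (U *v g))) \<le> s * norm (U *v g)"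
  shows "norm (V *v c - P *v (V *v c)) \<le> s * norm (V *v c)"
proof (cases "s < 1")
  case False
  then show ?thesis
    using norm_projector_residual_le[OF P, of "V *v c"]
      mult_right_mono[of 1 s "norm (V *v c)"] by simp
next
  case True
  have "linear ((*v) (transpose V ** U))" by simp
  moreover have "inj ((*v) (transpose V ** U))"
  \<comment> \<open>If V^T U g = 0, the residual of U g is U g itself, and \<open>UV\<close> with s
    < 1 forces it to vanish.\<close>
  proof (subst linear_injective_0, simp, intro allI impI)
    fix g assume "(transpose V ** U) *v g = 0"
    then have "norm (U *v g) \<le> s * norm (U *v g)"
      using UV[of g] by (simp flip: matrix_vector_mul_assoc)
    then have "(1 - s) * norm (U *v g) \<le> 0" by (simp add: algebra_simps)
    then have "U *v g = 0" using True by (simp add: mult_le_0_iff)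
    then show "g = 0" by (rule inj)
  qed
  ultimately have "surj ((*v) (transpose V ** U))"
    using linear_injective_imp_surjective by blast
  then obtain g where g: "transpose V *v (U *v g) = c"
    by (metis surjD matrix_vector_mul_assoc)
  define u where "u = U *v g"
  define w where "w = V *v c"
  have wu: "w \<bullet> u = w \<bullet> w"
  proof -
    have "w \<bullet> u = c \<bullet> (transpose V *v u)"
      by (metis w_def inner_matrix_transpose inner_commute)
    also have "\<dots> = c \<bullet> ((transpose V ** V) *v c)"
      using g V by (simp add: u_def orthonormal_columns_def)
    also have "\<dots> = w \<bullet> w"
      by (metis w_def inner_matrix_transpose inner_commute matrix_vector_mul_assoc)
    finally show ?thesis .
  qed
  show ?thesis
  proof (cases "u = 0")
    case True
    then have "w = 0" using wu by simp
    then show ?thesis by (simp flip: w_def)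
  next
    case False
    \<comment> \<open>As w . u = w . w, this t makes t u the orthogonal projection of w onto the
      line through u.\<close>
    define t where "t = (w \<bullet> w) / (u \<bullet> u)"
    have tu: "t * (u \<bullet> u) = w \<bullet> w" using False by (simp add: t_def)
    have uw: "norm (u - w) \<le> s * norm u"
      using UV[of g] unfolding g by (simp flip: u_def w_def)
    \<comment> \<open>P fixes t u, so w and w - t u have the same residual.\<close>
    have "w - P *v w = (w - t *\<^sub>R u) - P *v (w - t *\<^sub>R u)"
      by (simp add: u_def matrix_vector_mult_diff_distrib matrix_vector_mult_scaleR PU)
    then have "norm (w - P *v w) \<le> norm (w - t *\<^sub>R u)"
      using norm_projector_residual_le[OF P] by metis
    also have "\<dots> \<le> s * norm w"
    proof (rule power2_le_imp_le)
      \<comment> \<open>The ratios |w - t u| / |w| and |u - w| / |u| are both the sine of the angle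
        between u and w, so the bound for u carries over to w.\<close>
      have "(norm (w - t *\<^sub>R u))\<^sup>2 = w \<bullet> w - 2 * t * (w \<bullet> w) + t * (t * (u \<bullet> u))"
        using wu by (simp add: power2_norm_eq_inner inner_diff_left inner_diff_right
            inner_commute algebra_simps)
      also have "\<dots> = t * ((u \<bullet> u) - (w \<bullet> w))"
        unfolding tu by (simp add: tu[symmetric] algebra_simps)
      also have "(u \<bullet> u) - (w \<bullet> w) = (norm (u - w))\<^sup>2"
        using wu by (simp add: power2_norm_eq_inner inner_diff_left inner_diff_right inner_commute)
      also have "t * (norm (u - w))\<^sup>2 \<le> t * (s * norm u)\<^sup>2"
        using uw by (intro mult_left_mono power_mono) (auto simp: t_def)
      also have "\<dots> = (s * norm w)\<^sup>2"
        using tu by (simp add: power_mult_distrib power2_norm_eq_inner algebra_simps)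
      finally show "(norm (w - t *\<^sub>R u))\<^sup>2 \<le> (s * norm w)\<^sup>2" .
    qed (use s in simp)
    finally show ?thesis by (simp add: w_def)
  qed
qed

section \<open>Matrices diagonal in an orthonormal block basis\<close>

definition block_vec :: "real^'r \<Rightarrow> real^'s \<Rightarrow> real^('r + 's)" where
  "block_vec d e = (\<chi> k. case k of Inl i \<Rightarrow> d $ i | Inr j \<Rightarrow> e $ j)"

text \<open>Row and column index types differ because the eigenbasis formed by V and its complement
  has columns indexed by a sum type. With \<open>Q\<close> orthogonal, products, square roots and
  inverses are computed entrywise on \<open>d\<close>.\<close>

definition conj_diag :: "real^'m^'n \<Rightarrow> real^'m \<Rightarrow> real^'n^'n" where
  "conj_diag Q d = Q ** diag_matrix d ** transpose Q"

lemma sum_UNIV_Plus: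
  fixes f :: "'r::finite + 's::finite \<Rightarrow> 'c::comm_monoid_add"
  shows "sum f UNIV = (\<Sum>i\<in>UNIV. f (Inl i)) + (\<Sum>j\<in>UNIV. f (Inr j))"
  by (simp flip: UNIV_Plus_UNIV add: sum.Plus)

lemma diag_matrix_component: "(diag_matrix d *v x) $ i = d $ i * x $ i"
  by (simp add: matrix_vector_mult_def diag_matrix_def if_distribR if_distrib[of "\<lambda>z. z * _"]
      cong: if_cong)

lemma conj_diag_entry: "conj_diag Q d $ i $ j = (\<Sum>k\<in>UNIV. Q $ i $ k * d $ k * Q $ j $ k)"
proof -
  have "(Q ** diag_matrix d) $ i $ k = Q $ i $ k * d $ k" for k
    by (simp add: matrix_matrix_mult_def diag_matrix_def if_distrib[of "\<lambda>z. _ * z"]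
        cong: if_cong)
  then show ?thesis
    by (simp add: conj_diag_def matrix_matrix_mult_def[of "Q ** _"] transpose_def)
qed

lemma conj_diag_hblock:
  "conj_diag (hblock V W) (block_vec d e)
    = V ** diag_matrix d ** transpose V + W ** diag_matrix e ** transpose W"
  by (simp add: vec_eq_iff conj_diag_entry sum_UNIV_Plus hblock_def block_vec_def
      flip: conj_diag_def)

lemma transpose_conj_diag: "transpose (conj_diag Q d) = conj_diag Q d"
  by (simp add: vec_eq_iff transpose_def conj_diag_entry mult.commute mult.left_commute)

lemma diag_matrix_mult:
  "diag_matrix d ** diag_matrix e = diag_matrix (\<chi> i. d $ i * e $ i)"
  by (simp add: matrix_eq vec_eq_iff diag_matrix_component flip: matrix_vector_mul_assoc)

lemma diag_matrix_1: "diag_matrix (\<chi> i. 1) = mat 1"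
  by (simp add: diag_matrix_def mat_def vec_eq_iff)

lemma conj_diag_mult:
  assumes "transpose Q ** Q = mat 1"
  shows "conj_diag Q d ** conj_diag Q e = conj_diag Q (\<chi> i. d $ i * e $ i)"
proof -
  have "conj_diag Q d ** conj_diag Q e
      = Q ** diag_matrix d ** (transpose Q ** Q) ** diag_matrix e ** transpose Q"
    by (simp add: conj_diag_def matrix_mul_assoc)
  then show ?thesis
    by (simp add: assms conj_diag_def flip: diag_matrix_mult matrix_mul_assoc)
qed

lemma conj_diag_1:
  assumes "Q ** transpose Q = mat 1"
  shows "conj_diag Q (\<chi> i. 1) = mat 1"
  by (simp add: conj_diag_def diag_matrix_1 assms)

lemma conj_diag_quadratic_form:
  "x \<bullet> (conj_diag Q d *v x) = (\<Sum>k\<in>UNIV. d $ k * ((transpose Q *v x) $ k)\<^sup>2)"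
proof -
  have "x \<bullet> (conj_diag Q d *v x)
      = (transpose Q *v x) \<bullet> (diag_matrix d *v (transpose Q *v x))"
    by (simp add: conj_diag_def inner_matrix_transpose matrix_transpose_mul
        flip: matrix_vector_mul_assoc)
  then show ?thesis
    by (simp add: inner_vec_def diag_matrix_component power2_eq_square mult_ac)
qed

lemma eigenvalue_diag_matrix: "{c. eigenvalue (diag_matrix d) c} = range (($) d)"
proof (intro equalityI subsetI)
  fix c assume "c \<in> {c. eigenvalue (diag_matrix d) c}"
  then obtain x where "x \<noteq> 0" "diag_matrix d *v x = c *s x" by (auto simp: eigenvalue_def)
  then obtain i where "x $ i \<noteq> 0" "d $ i * x $ i = c * x $ i"
    by (auto simp: vec_eq_iff diag_matrix_component)
  then show "c \<in> range (($) d)" by auto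
next
  fix c assume "c \<in> range (($) d)"
  then obtain i where c: "c = d $ i" by auto
  have "diag_matrix d *v axis i 1 = c *s axis i 1"
    by (simp add: vec_eq_iff diag_matrix_component c axis_def)
  moreover have "axis i (1::real) \<noteq> 0" by simp
  ultimately show "c \<in> {c. eigenvalue (diag_matrix d) c}"
    unfolding eigenvalue_def by blast
qed

lemma lambda_diag_matrix:
  "d $ i \<le> lambda_max (diag_matrix d)" "lambda_min (diag_matrix d) \<le> d $ i"
  by (auto simp: lambda_max_def lambda_min_def eigenvalue_diag_matrix)

text \<open>\<open>R\<close> carries an eigenvector of \<open>M\<close> to one of \<open>N\<close>,
  and its left inverse keeps the image nonzero. Used in both directions, this identifies the two
  spectra.\<close>

lemma eigenvalue_similar:
  fixes M N R R' :: "real^'n^'n"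
  assumes "R ** M = N ** R" "R' ** R = mat 1" "eigenvalue M c"
  shows "eigenvalue N c"
proof -
  obtain x where x: "x \<noteq> 0" "M *v x = c *s x" using assms(3) by (auto simp: eigenvalue_def)
  have "N *v (R *v x) = R *v (M *v x)"
    by (simp add: matrix_vector_mul_assoc assms(1))
  also have "\<dots> = c *s (R *v x)" by (simp add: x(2) vector_scalar_commute)
  finally have "N *v (R *v x) = c *s (R *v x)" .
  moreover have "R *v x \<noteq> 0"
    using x(1) assms(2) by (metis matrix_vector_mul_assoc matrix_vector_mul_lid matrix_vector_mult_0_right)
  ultimately show ?thesis unfolding eigenvalue_def by blast
qed

section \<open>Spectral norm, orthonormal columns and the distance of subspaces\<close>

lemma norm_le_spectral_norm: "norm (M *v x) \<le> spectral_norm M * norm x"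
  unfolding spectral_norm_def by (rule onorm) (rule matrix_vector_mul_bounded_linear)

lemma projector_of_orthonormal_columns:
  assumes "orthonormal_columns Z"
  shows "transpose (Z ** transpose Z) = Z ** transpose Z"
    "(Z ** transpose Z) ** (Z ** transpose Z) = Z ** transpose Z"
  using projector_mult_projector[OF assms, of Z] by (simp_all add: matrix_transpose_mul)

lemma norm_orthonormal_columns:
  assumes "orthonormal_columns Z"
  shows "norm (Z *v g) = norm g"
proof -
  have "(Z *v g) \<bullet> (Z *v g) = ((transpose Z ** Z) *v g) \<bullet> g"
    by (simp add: inner_matrix_transpose flip: matrix_vector_mul_assoc)
  then show ?thesis using assms by (simp add: norm_eq_sqrt_inner orthonormal_columns_def)
qed

text \<open>This is \<open>norm_projector_diff_le\<close> with s = 1. It is the upper bound that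
  keeps the distance in the domain of \<open>arcsin\<close>.\<close>

lemma subspace_dist_le_1:
  assumes Z: "orthonormal_columns Z" and V: "orthonormal_columns V"
  shows "subspace_dist Z V \<le> 1"
proof -
  note p = projector_of_orthonormal_columns
  have "norm ((Z ** transpose Z - V ** transpose V) *v x) \<le> 1 * norm x" for x
    unfolding matrix_vector_mult_diff_rdistrib
    using norm_projector_residual_le[OF p[OF Z]] norm_projector_residual_le[OF p[OF V]]
    by (intro norm_projector_diff_le p Z V) auto
  then show ?thesis
    unfolding subspace_dist_def spectral_norm_def by (intro onorm_bound) auto
qed

lemma coordinates_hblock:
  "(transpose (hblock V W) *v x) $ Inl i = (transpose V *v x) $ i"
  by (simp add: matrix_vector_mult_def transpose_def hblock_def del: transpose_matrix_vector)

text \<open>The hypothesis says that \<open>transpose Q\<close> has orthonormal columns, so it is an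
  isometry.\<close>

lemma parseval:
  assumes "Q ** transpose Q = mat 1"
  shows "(\<Sum>k\<in>UNIV. ((transpose Q *v x) $ k)\<^sup>2) = (norm x)\<^sup>2"
proof -
  have "orthonormal_columns (transpose Q)" using assms by (simp add: orthonormal_columns_def)
  then show ?thesis
    by (metis (mono_tags, lifting) norm_orthonormal_columns power2_norm_eq_inner inner_vec_def
        inner_real_def power2_eq_square sum.cong)
qed

section \<open>The Gram matrix and the projector onto the range of U\<close>

text \<open>A kernel vector g of E satisfies |U g|^2 = (E g) . g = 0, so full column rank makes E
  invertible. P is then the usual formula for the orthogonal projector onto the range of U in a
  basis that need not be orthonormal.\<close>

lemma gram_projector:
  fixes U :: "real^'r^'n"
  assumes E: "E = transpose U ** U" and inj: "\<And>g. U *v g = 0 \<Longrightarrow> g = 0"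
  defines "P \<equiv> U ** matrix_inv E ** transpose U"
  shows "E ** matrix_inv E = mat 1" "transpose P = P" "P ** P = P" "P *v (U *v g) = U *v g"
proof -
  let ?F = "matrix_inv E"
  have "g = 0" if "E *v g = 0" for g
  proof (rule inj)
    have "(U *v g) \<bullet> (U *v g) = (E *v g) \<bullet> g"
      by (simp only: E inner_matrix_transpose matrix_vector_mul_assoc)
    then show "U *v g = 0" using that by simp
  qed
  then have "invertible E"
    by (meson invertible_left_inverse matrix_left_invertible_ker)
  then have EF: "E ** ?F = mat 1" and FE: "?F ** E = mat 1"
    unfolding invertible_def matrix_inv_def by (metis (mono_tags, lifting) someI_ex)+
  have "transpose E = E" by (simp add: E matrix_transpose_mul)
  then have "transpose ?F = transpose ?F ** (transpose E ** ?F)"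
    using EF by simp
  also have "\<dots> = transpose (E ** ?F) ** ?F"
    by (simp add: matrix_transpose_mul matrix_mul_assoc)
  also have "\<dots> = ?F" using EF by simp
  finally have F: "transpose ?F = ?F" .
  show "E ** ?F = mat 1" by (rule EF)
  show "transpose P = P" by (simp add: P_def matrix_transpose_mul F matrix_mul_assoc)
  have "P ** U = U ** (?F ** E)" by (simp add: P_def E matrix_mul_assoc)
  then have PU: "P ** U = U" by (simp add: FE)
  then show "P *v (U *v g) = U *v g" by (simp only: matrix_vector_mul_assoc)
  show "P ** P = P"
    using PU by (metis P_def matrix_mul_assoc)
qed

text \<open>Cauchy-Schwarz for |g|^2 = (U g) . (U F g), where |U F g|^2 = (F g) . g is at most the
  norm of F times |g|^2. The result bounds the least singular value of U from below.\<close>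

lemma norm_le_gram_inverse:
  fixes U :: "real^'r^'n"
  assumes E: "E = transpose U ** U" and EF: "E ** F = mat 1"
  shows "(norm g)\<^sup>2 \<le> spectral_norm F * (norm (U *v g))\<^sup>2"
proof (cases "g = 0")
  case False
  have gram: "(U *v x) \<bullet> (U *v (F *v y)) = x \<bullet> y" for x y
    by (metis E EF inner_matrix_transpose inner_commute matrix_vector_mul_assoc
        matrix_vector_mul_lid)
  have "(norm (U *v (F *v g)))\<^sup>2 = (F *v g) \<bullet> g"
    using gram[of "F *v g" g] by (simp add: power2_norm_eq_inner)
  also have "\<dots> \<le> norm (F *v g) * norm g" by (rule norm_cauchy_schwarz)
  also have "\<dots> \<le> (spectral_norm F * norm g) * norm g"
    by (intro mult_right_mono norm_le_spectral_norm norm_ge_zero)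
  finally have 1: "(norm (U *v (F *v g)))\<^sup>2 \<le> spectral_norm F * (norm g)\<^sup>2"
    by (simp add: power2_eq_square)
  have "(norm g)\<^sup>2 = (U *v g) \<bullet> (U *v (F *v g))"
    by (simp add: gram power2_norm_eq_inner)
  then have "(norm g)\<^sup>2 \<le> norm (U *v g) * norm (U *v (F *v g))"
    by (metis norm_cauchy_schwarz)
  then have "((norm g)\<^sup>2)\<^sup>2 \<le> (norm (U *v g) * norm (U *v (F *v g)))\<^sup>2"
    by (intro power_mono) auto
  also have "\<dots> \<le> (norm (U *v g))\<^sup>2 * (spectral_norm F * (norm g)\<^sup>2)"
    unfolding power_mult_distrib by (intro mult_left_mono 1) auto
  finally have "(norm g)\<^sup>2 * (norm g)\<^sup>2 \<le> (spectral_norm F * (norm (U *v g))\<^sup>2) * (norm g)\<^sup>2"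
    by (simp only: power2_eq_square mult_ac)
  then show ?thesis
    by (rule mult_right_le_imp_le) (use False in simp)
qed simp

text \<open>Because R commutes with the projector onto V, the residual of U g is R w, where w is the
  residual of Z g. The bound on R, the subspace distance and the Gram estimate for |g| in terms of
  |U g| contribute one factor each.\<close>

lemma projector_distance_transformed:
  fixes Z V :: "real^'r^'n" and R :: "real^'n^'n"
  assumes Z: "orthonormal_columns Z" and V: "orthonormal_columns V"
    and comm: "(V ** transpose V) ** R = R ** (V ** transpose V)"
    and U: "U = R ** Z"
    and EF: "(transpose U ** U) ** F = mat 1"
    and b: "0 \<le> b"
    and R: "\<And>w. transpose V *v w = 0 \<Longrightarrow> (norm (R *v w))\<^sup>2 \<le> b * (norm w)\<^sup>2"
  shows "norm (U *v g - V *v (transpose V *v (U *v g)))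
    \<le> sqrt (b * spectral_norm F) * subspace_dist Z V * norm (U *v g)"
proof -
  let ?d = "subspace_dist Z V"
  have nonneg: "0 \<le> spectral_norm F" "0 \<le> ?d"
    by (simp_all add: spectral_norm_def subspace_dist_def onorm_pos_le)
  define w where "w = Z *v g - (V ** transpose V) *v (Z *v g)"
  have "U *v g - V *v (transpose V *v (U *v g))
      = R *v (Z *v g) - ((V ** transpose V) ** R) *v (Z *v g)"
    by (simp only: U matrix_vector_mul_assoc matrix_mul_assoc)
  also have "\<dots> = R *v w"
    by (simp only: w_def comm matrix_vector_mult_diff_distrib matrix_vector_mul_assoc
        matrix_mul_assoc)
  finally have eq: "U *v g - V *v (transpose V *v (U *v g)) = R *v w" .
  have "transpose V *v ((V ** transpose V) *v x) = transpose V *v x" for x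
  proof -
    have "transpose V ** (V ** transpose V) = transpose V"
      using V by (simp add: orthonormal_columns_def matrix_mul_assoc)
    then show ?thesis by (metis matrix_vector_mul_assoc)
  qed
  then have "transpose V *v w = 0"
    by (simp only: w_def matrix_vector_mult_diff_distrib) simp
  then have "(norm (R *v w))\<^sup>2 \<le> b * (norm w)\<^sup>2" by (rule R)
  \<comment> \<open>The projector onto the span of Z fixes Z g, so w is the difference of the two
    projectors applied to Z g.\<close>
  also have "w = (Z ** transpose Z - V ** transpose V) *v (Z *v g)"
  proof -
    have "(Z ** transpose Z) *v (Z *v g) = (Z ** (transpose Z ** Z)) *v g"
      by (simp only: matrix_vector_mul_assoc matrix_mul_assoc)
    also have "\<dots> = Z *v g" using Z by (simp add: orthonormal_columns_def)
    finally show ?thesis by (simp only: w_def matrix_vector_mult_diff_rdistrib)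
  qed
  then have "norm w \<le> ?d * norm g"
    using norm_le_spectral_norm[of "Z ** transpose Z - V ** transpose V" "Z *v g"]
    by (simp only: subspace_dist_def norm_orthonormal_columns[OF Z])
  then have "b * (norm w)\<^sup>2 \<le> b * (?d * norm g)\<^sup>2"
    using b by (intro mult_left_mono power_mono) auto
  also have "\<dots> = b * ?d\<^sup>2 * (norm g)\<^sup>2" by (simp add: power_mult_distrib)
  also have "\<dots> \<le> b * ?d\<^sup>2 * (spectral_norm F * (norm (U *v g))\<^sup>2)"
    using b EF by (intro mult_left_mono norm_le_gram_inverse) auto
  also have "\<dots> = (sqrt (b * spectral_norm F) * ?d * norm (U *v g))\<^sup>2"
    using b nonneg by (simp add: power_mult_distrib)
  finally show ?thesis
    unfolding eq by (rule power2_le_imp_le) (use b nonneg in simp)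
qed

text \<open>\<open>sqrt k\<close> is the geometric mean of k and 1, hence at most (k + 1)/2, and the
  sine d is at most the tangent because the cosine is at most 1. The two sine terms are
  nonnegative.\<close>

lemma sqrt_sin_le_mean_tan:
  assumes d: "0 \<le> d" "d \<le> 1" and k: "0 \<le> k" and cos: "cos (arcsin d) \<noteq> 0"
  shows "sqrt k * d \<le> 1/2 * (k + 1) * tan (arcsin d) + sin (arcsin d) + (sin (arcsin d))\<^sup>2"
proof -
  have sin: "sin (arcsin d) = d" using d by simp
  \<comment> \<open>The cosine is nonnegative on the range of \<open>arcsin\<close>, so the
    hypothesis makes it positive. This excludes d = 1, where division by zero would give
    \<open>tan\<close> the value 0.\<close>
  have c: "0 < cos (arcsin d)"
    using cos d arcsin_bounded[of d] cos_ge_zero[of "arcsin d"] by simp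
  have "d * cos (arcsin d) \<le> d" using d(1) by (simp add: mult_left_le)
  then have tan: "d \<le> tan (arcsin d)"
    using c by (simp add: tan_def sin field_simps)
  have "sqrt k \<le> 1/2 * (k + 1)"
    using arith_geo_mean_sqrt[of k 1] k by simp
  then have "sqrt k * d \<le> 1/2 * (k + 1) * tan (arcsin d)"
    using tan d k by (intro mult_mono) auto
  then show ?thesis unfolding sin using d(1) zero_le_power2[of d] by linarith
qed

theorem theorem3p7:
  fixes A :: "real^'n^'n"
    and V Z :: "real^'r^'n" and V\<^sub>p :: "real^'s^'n"
    and lam :: "real^'r" and lam\<^sub>p :: "real^'s"
    and \<Lambda> E :: "real^'r^'r" and \<Lambda>\<^sub>p :: "real^'s^'s"
    and P\<^sub>C :: "real^'n^'n" and \<theta> \<epsilon>\<^sub>C :: real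
  assumes A: "sym_posdef A"
    and orth: "orthogonal_square (hblock V V\<^sub>p)"
    and Lam: "\<Lambda> = diag_matrix lam"
    and Lamp: "\<Lambda>\<^sub>p = diag_matrix lam\<^sub>p"
    and spectral: "A = V ** \<Lambda> ** transpose V + V\<^sub>p ** \<Lambda>\<^sub>p ** transpose V\<^sub>p"
    and ordered: "\<forall>i j. lam $ i \<le> lam\<^sub>p $ j"
    and Z: "orthonormal_columns Z"
    and E: "E = transpose Z ** A ** Z"
    and PC: "P\<^sub>C = mat 1 + Z ** matrix_inv E ** transpose Z"
    and theta: "\<theta> = acute_angle Z V"
    and cos: "cos \<theta> \<noteq> 0"
    and eps: "\<epsilon>\<^sub>C = 1/2 * (lambda_max \<Lambda>\<^sub>p * spectral_norm (matrix_inv E) + 1) * tan \<theta>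
                + sin \<theta> + (sin \<theta>)\<^sup>2"
  shows "lambda_max (P\<^sub>C ** A) \<le> max (1 + lambda_max \<Lambda>) (lambda_max \<Lambda>\<^sub>p) + \<epsilon>\<^sub>C
       \<and> lambda_min (P\<^sub>C ** A) \<ge> min (1 + lambda_min \<Lambda>) (lambda_min \<Lambda>\<^sub>p) - \<epsilon>\<^sub>C"
proof -

  \<comment> \<open>Square root of A and simultaneous diagonalization with W\<close>
  define Q where "Q = hblock V V\<^sub>p"
  define \<mu> where "\<mu> = block_vec lam lam\<^sub>p"
  have QQ: "transpose Q ** Q = mat 1" and QQ': "Q ** transpose Q = mat 1"
    using orth by (auto simp: orthogonal_square_def Q_def)
  have A_Q: "A = conj_diag Q \<mu>"
    by (simp add: spectral Lam Lamp Q_def \<mu>_def conj_diag_hblock)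
  have \<mu>_pos: "0 < \<mu> $ k" for k
  proof -
    \<comment> \<open>The k-th column of Q is an eigenvector for \<open>\<mu> $ k\<close>, and
      positive definiteness is tested on it.\<close>
    let ?y = "Q *v axis k 1"
    have y: "transpose Q *v ?y = axis k 1"
      by (simp only: matrix_vector_mul_assoc QQ matrix_vector_mul_lid)
    moreover have "axis k (1::real) \<noteq> 0" by simp
    ultimately have "?y \<noteq> 0" by (metis matrix_vector_mult_0_right)
    then have "0 < ?y \<bullet> (A *v ?y)" using A by (simp add: sym_posdef_def)
    also have "\<dots> = (\<Sum>j\<in>UNIV. \<mu> $ j * (axis k 1 $ j)\<^sup>2)"
      by (simp only: A_Q conj_diag_quadratic_form y)
    also have "\<dots> = \<mu> $ k"
      by (simp add: axis_def if_distrib[of "\<lambda>z. _ * z\<^sup>2"] cong: if_cong)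
    finally show ?thesis .
  qed
  define R where "R = conj_diag Q (\<chi> k. sqrt (\<mu> $ k))"
  define R' where "R' = conj_diag Q (\<chi> k. 1 / sqrt (\<mu> $ k))"
  have RR: "R ** R = A"
    using \<mu>_pos by (simp add: R_def conj_diag_mult[OF QQ] A_Q less_imp_le)
  have R'R: "R' ** R = mat 1" and RR': "R ** R' = mat 1"
    using \<mu>_pos less_irrefl
    by (simp_all add: R_def R'_def conj_diag_mult[OF QQ] flip: conj_diag_1[OF QQ'])
      (metis less_irrefl)+
  have RT: "transpose R = R" by (simp add: R_def transpose_conj_diag)
  have V: "orthonormal_columns V"
    unfolding orthonormal_columns_def vec_eq_iff
  proof (intro allI)
    fix i j
    have "(transpose V ** V) $ i $ j = (transpose Q ** Q) $ Inl i $ Inl j"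
      by (simp add: matrix_matrix_mult_def transpose_def Q_def hblock_def)
    then show "(transpose V ** V) $ i $ j = mat 1 $ i $ j"
      by (simp add: QQ mat_def)
  qed
  define W where "W = V ** transpose V"
  \<comment> \<open>These are the eigenvalues of W in the basis Q: one on V, zero on its complement.
    Sharing this basis, W commutes with R, and the eigenvalues of A + W are sums.\<close>
  define \<iota> :: "real^('r + 's)" where "\<iota> = block_vec (\<chi> i. 1) (\<chi> j. 0)"
  have W_Q: "W = conj_diag Q \<iota>"
    by (simp add: W_def \<iota>_def Q_def vec_eq_iff conj_diag_entry sum_UNIV_Plus hblock_def
        block_vec_def matrix_matrix_mult_def transpose_def)
  have WR: "W ** R = R ** W"
    by (simp add: W_Q R_def conj_diag_mult[OF QQ] mult.commute)
  define U where "U = R ** Z"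
  define P where "P = U ** matrix_inv E ** transpose U"
  have U_inj: "g = 0" if "U *v g = 0" for g
  proof -
    have "Z *v g = R' *v (U *v g)"
      by (simp add: U_def matrix_vector_mul_assoc matrix_mul_assoc R'R)
    then have "norm (Z *v g) = 0" using that by simp
    then show ?thesis by (simp add: norm_orthonormal_columns[OF Z])
  qed
  have E_U: "E = transpose U ** U"
    by (simp add: E U_def matrix_transpose_mul RT matrix_mul_assoc flip: RR)
  note gram = gram_projector[OF E_U U_inj, folded P_def]

  \<comment> \<open>Bound on the difference of the projectors P and W\<close>
  define b where "b = lambda_max \<Lambda>\<^sub>p"
  define d where "d = subspace_dist Z V"
  define k where "k = b * spectral_norm (matrix_inv E)"
  define s where "s = sqrt k * d"
  have \<mu>_b: "\<mu> $ Inr j \<le> b" for j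
    using lambda_diag_matrix(1)[of lam\<^sub>p j] by (simp add: \<mu>_def block_vec_def b_def Lamp)
  have b: "0 \<le> b" using \<mu>_pos \<mu>_b by (meson less_imp_le order_trans)
  have k: "0 \<le> k" using b by (simp add: k_def spectral_norm_def onorm_pos_le)
  have d: "0 \<le> d" "d \<le> 1"
    using subspace_dist_le_1[OF Z V]
    by (simp_all add: d_def) (simp add: subspace_dist_def spectral_norm_def onorm_pos_le)
  have s: "0 \<le> s" using k d by (simp add: s_def)
  have s_eps: "s \<le> \<epsilon>\<^sub>C"
    using sqrt_sin_le_mean_tan[OF d k] cos
    by (simp add: s_def eps theta acute_angle_def k_def b_def flip: d_def)

  \<comment> \<open>|R w|^2 = w . (A w) is a weighted sum of squared eigenbasis coordinates. Those
    along V vanish, and the other weights are at most b.\<close>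
  have R_perp: "(norm (R *v w))\<^sup>2 \<le> b * (norm w)\<^sup>2" if w: "transpose V *v w = 0" for w
  proof -
    have "(norm (R *v w))\<^sup>2 = w \<bullet> (A *v w)"
      by (metis RR RT inner_commute inner_matrix_transpose matrix_vector_mul_assoc
          power2_norm_eq_inner)
    also have "\<dots> = (\<Sum>k\<in>UNIV. \<mu> $ k * ((transpose Q *v w) $ k)\<^sup>2)"
      by (simp only: A_Q conj_diag_quadratic_form)
    also have "\<dots> \<le> (\<Sum>k\<in>UNIV. b * ((transpose Q *v w) $ k)\<^sup>2)"
    proof (rule sum_mono)
      fix k
      show "\<mu> $ k * ((transpose Q *v w) $ k)\<^sup>2 \<le> b * ((transpose Q *v w) $ k)\<^sup>2"
      proof (cases k)
        case (Inl i)
        then show ?thesis using w coordinates_hblock[of V V\<^sub>p w i] by (simp add: Q_def)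
      next
        case (Inr j)
        then show ?thesis using \<mu>_b by (simp add: mult_right_mono)
      qed
    qed
    also have "\<dots> = b * (norm w)\<^sup>2"
      by (simp only: parseval[OF QQ'] flip: sum_distrib_left)
    finally show ?thesis .
  qed
  have UV: "norm (U *v g - V *v (transpose V *v (U *v g))) \<le> s * norm (U *v g)" for g
    unfolding s_def k_def d_def
    using gram(1) E_U WR
    by (intro projector_distance_transformed[OF Z V _ U_def _ b R_perp]) (simp_all add: W_def)
  \<comment> \<open>Every \<open>P *v x\<close> has the form U g with g = E^-1 U^T x, so
    \<open>UV\<close> applies.\<close>
  have PW: "norm (P *v x - W *v (P *v x)) \<le> s * norm (P *v x)" for x
    using UV[of "matrix_inv E *v (transpose U *v x)"]
    by (simp only: P_def W_def matrix_vector_mul_assoc matrix_mul_assoc)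
  have WP: "norm (W *v x - P *v (W *v x)) \<le> s * norm (W *v x)" for x
  proof -
    have "W *v x = V *v (transpose V *v x)"
      by (simp only: W_def matrix_vector_mul_assoc)
    then show ?thesis
      using equal_dim_projector_bound[OF gram(2,3) V gram(4) U_inj s UV] by metis
  qed
  have PW_diff: "\<bar>x \<bullet> (P *v x) - x \<bullet> (W *v x)\<bar> \<le> s * (norm x)\<^sup>2" for x
  proof -
    have "\<bar>x \<bullet> (P *v x - W *v x)\<bar> \<le> norm x * norm (P *v x - W *v x)"
      by (rule Cauchy_Schwarz_ineq2)
    also have "\<dots> \<le> norm x * (s * norm x)"
      using projector_of_orthonormal_columns[OF V]
      by (intro mult_left_mono norm_projector_diff_le gram s PW WP) (auto simp: W_def)
    finally show ?thesis by (simp add: inner_diff_right power2_eq_square mult_ac)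
  qed

  \<comment> \<open>Spectral bounds for A + W\<close>
  define lo where "lo = min (1 + lambda_min \<Lambda>) (lambda_min \<Lambda>\<^sub>p)"
  define hi where "hi = max (1 + lambda_max \<Lambda>) (lambda_max \<Lambda>\<^sub>p)"
  have bounds: "lo \<le> \<mu> $ k + \<iota> $ k" "\<mu> $ k + \<iota> $ k \<le> hi" for k
    using lambda_diag_matrix[of lam] lambda_diag_matrix[of lam\<^sub>p]
    by (auto simp: \<mu>_def \<iota>_def block_vec_def Lam Lamp lo_def hi_def le_max_iff_disj min_le_iff_disj
        add.commute split: sum.split)
  have AW: "lo * (norm x)\<^sup>2 \<le> x \<bullet> (A *v x) + x \<bullet> (W *v x)"
    "x \<bullet> (A *v x) + x \<bullet> (W *v x) \<le> hi * (norm x)\<^sup>2" for x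
  proof -
    have eq: "x \<bullet> (A *v x) + x \<bullet> (W *v x)
        = (\<Sum>k\<in>UNIV. (\<mu> $ k + \<iota> $ k) * ((transpose Q *v x) $ k)\<^sup>2)"
      by (simp only: A_Q W_Q conj_diag_quadratic_form distrib_right sum.distrib)
    show "lo * (norm x)\<^sup>2 \<le> x \<bullet> (A *v x) + x \<bullet> (W *v x)"
      "x \<bullet> (A *v x) + x \<bullet> (W *v x) \<le> hi * (norm x)\<^sup>2"
      unfolding eq parseval[OF QQ', symmetric] sum_distrib_left
      by (intro sum_mono mult_right_mono bounds zero_le_power2)+
  qed

  \<comment> \<open>Similarity to A + P and the eigenvalue bounds\<close>
  \<comment> \<open>With A = R R and U^T = Z^T R, the left side expands to R R R + U E^-1 U^T
    R.\<close>
  have sim: "R ** (P\<^sub>C ** A) = (A + P) ** R"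
    by (simp add: PC P_def U_def matrix_transpose_mul RT matrix_add_ldistrib matrix_mult_add_right_distrib
        matrix_mul_assoc flip: RR)
  have sim': "R' ** (A + P) = (P\<^sub>C ** A) ** R'"
  proof -
    have "R' ** (A + P) = R' ** ((A + P) ** R) ** R'"
      by (metis RR' matrix_mul_assoc matrix_mul_rid)
    also have "\<dots> = (R' ** R) ** (P\<^sub>C ** A) ** R'"
      by (simp only: matrix_mul_assoc flip: sim)
    finally show ?thesis by (simp only: R'R matrix_mul_lid)
  qed
  have eigenvalues: "{c. eigenvalue (P\<^sub>C ** A) c} = {c. eigenvalue (A + P) c}"
    using eigenvalue_similar[OF sim R'R] eigenvalue_similar[OF sim' RR'] by blast
  have "transpose (A + P) = A + P"
    using A gram(2) by (simp add: sym_posdef_def transpose_def vec_eq_iff)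
  \<comment> \<open>The spectrum of the symmetric matrix A + P is finite and nonempty, so
    \<open>Max\<close> and \<open>Min\<close> over it are attained and bounding each eigenvalue
    suffices.\<close>
  then have fin: "finite {c. eigenvalue (P\<^sub>C ** A) c}"
    and ne: "{c. eigenvalue (P\<^sub>C ** A) c} \<noteq> {}"
    unfolding eigenvalues
    using symmetric_finite_eigenvalues symmetric_has_eigenvalue by auto
  have "c \<le> hi + \<epsilon>\<^sub>C \<and> lo - \<epsilon>\<^sub>C \<le> c" if c: "eigenvalue (P\<^sub>C ** A) c" for c
  proof -
    obtain x where x: "x \<noteq> 0" "(A + P) *v x = c *s x"
      using c eigenvalues unfolding eigenvalue_def by blast
    \<comment> \<open>At an eigenvector of A + P the Rayleigh quotient equals c, and it differs from
      that of A + W by at most s.\<close>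
    have "c * (norm x)\<^sup>2 = x \<bullet> (A *v x) + x \<bullet> (P *v x)"
      using x(2) by (simp add: scalar_mult_eq_scaleR power2_norm_eq_inner matrix_vector_mult_add_rdistrib
          flip: inner_add_right)
    then have "c * (norm x)\<^sup>2 \<le> (hi + s) * (norm x)\<^sup>2" "(lo - s) * (norm x)\<^sup>2 \<le> c * (norm x)\<^sup>2"
      using AW[of x] PW_diff[of x] by (auto simp: algebra_simps)
    then have "c \<le> hi + s" "lo - s \<le> c" using x(1) by simp_all
    then show ?thesis using s_eps by simp
  qed
  then show ?thesis
    using fin ne by (simp add: lambda_max_def[of "P\<^sub>C ** A"] lambda_min_def[of "P\<^sub>C ** A"]
        flip: lo_def hi_def)
qed

end
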